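(* Let $m>0$, $X>0$, let $K\in C([0,X]^2)$ satisfy $0<C\le K(x,t)\le D$, and let $y=y(x)$ be the nontrivial (positive) solution of $y(x)^{m+1}=\int_0^x K(x,t)y(t)\,dt$, $x\in[0,X]$. For $N\in\mathbb{N}$ put $h=X/N$, and let $y_n$, $n=1,\dots,N$, be produced from a starting value $y_1$ by the explicit scheme $$y_n^{m+1}=h\sum_{i=1}^{n-1}w_{n,i}K(nh,ih)\,y_i,\qquad n=2,3,\dots,N,$$ with weights satisfying $0<w_{n,i}\le W$ for some constant $W>0$. Denote the error of the scheme by $e_n:=y(nh)-y_n$. Let $\delta(h)$ and $\epsilon(h)$ be the maximal local consistency errors of the quadrature defined in the context, and assume that $\epsilon(h)h^{-\frac{m+1}{m}}<1$ as $h\to0^+$. If $y_1$ satisfies $$y_1\ge\left(1-\frac{m+1}{m}\frac{\epsilon(h)}{h^{1+\frac1m}}\right)\left(C\frac{m}{m+1}h\right)^{\frac1m}$$ and $|e_1|=O(h^p)$ for some $p>0$, then $$|e_n|\le \text{const.}\times h^{\,1-\frac1m\frac{WD}{C\,E(h)}}\,\max\{h^p,\ \delta(h)h^{-1}\}\quad\text{as } h\to0^+ \text{ with } nh\to x,$$ where $x\in(0,X]$ is a fixed point and $E(h):=1-\frac{m+1}{m}\epsilon(h)h^{-\frac{m+1}{m}}=O(1)$ as $h\to0^+$.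
   Context: The grid points are $x_n=nh$, $n=0,1,\dots,N$, with $h=X/N$; the limit $h\to0^+$ means $N\to\infty$. The positive solution $y$ exists and is unique; the equation also has the trivial solution $0$. Local consistency error for the integral equation: $\delta_n(h):=\int_0^{nh}K(nh,t)y(t)\,dt-h\sum_{i=1}^{n-1}w_{n,i}K(nh,ih)y(ih)$ and $\delta(h):=\max_{1\le n\le N}|\delta_n(h)|$. Local consistency error of the same quadrature applied to the function $t^{1/m}$: $\epsilon_n(h):=\int_0^{nh}t^{1/m}\,dt-h\sum_{i=1}^{n-1}w_{n,i}(ih)^{1/m}$ and $\epsilon(h):=\max_{1\le n\le N}|\epsilon_n(h)|$. The constant in the bound does not depend on $h$.
   Formalization: Here ε(h) is the maximum of |ε_n(h)| over 2≤n≤N instead of 1≤n≤N (n=1 would force E(h)≤0), and E(h)>0 for all small h is assumed in addition to ε(h)h^{-(m+1)/m}<1; without these changes the claim is false or its exponent is undefined. *)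

theory Defs
  imports "HOL-Analysis.Analysis" "HOL-Library.Landau_Symbols"
begin

text \<open>
  Throughout, the grid with \<open>N\<close> subintervals of \<open>[0, X]\<close> has step \<open>h = X / N\<close>, and
  \<open>h \<rightarrow> 0+\<close> is expressed by \<open>N \<rightarrow> \<infinity>\<close>. Real powers of nonnegative numbers are
  written with \<open>powr\<close>, so that \<open>0 powr a = 0\<close>.
\<close>

definition grid_step :: "real \<Rightarrow> nat \<Rightarrow> real" where
  "grid_step X N = X / real N"

text \<open>
  Positivity on \<open>(0, X]\<close> excludes the trivial solution as well as its extensions that vanish on an
  initial interval; the equation at \<open>x = 0\<close> forces \<open>y 0 = 0\<close>.
\<close>

definition positive_solution ::
  "real \<Rightarrow> real \<Rightarrow> (real \<Rightarrow> real \<Rightarrow> real) \<Rightarrow> (real \<Rightarrow> real) \<Rightarrow> bool" where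
  "positive_solution m X K y \<longleftrightarrow>
     continuous_on {0..X} y \<and> (\<forall>x\<in>{0<..X}. 0 < y x) \<and>
     (\<forall>x\<in>{0..X}. y x powr (m + 1) = integral {0..x} (\<lambda>t. K x t * y t))"

text \<open>
  The starting value \<open>u 1\<close> is free. For \<open>n \<ge> 2\<close> the value \<open>u n\<close> is the nonnegative \<open>(m+1)\<close>-st root;
  without the sign condition \<open>powr\<close> would not determine it.
\<close>

definition explicit_scheme ::
  "real \<Rightarrow> real \<Rightarrow> (real \<Rightarrow> real \<Rightarrow> real) \<Rightarrow> (nat \<Rightarrow> nat \<Rightarrow> real) \<Rightarrow> nat \<Rightarrow> (nat \<Rightarrow> real) \<Rightarrow> bool" where
  "explicit_scheme m X K w N u \<longleftrightarrow>
     (let h = grid_step X N in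
      \<forall>n\<in>{2..N}. 0 \<le> u n \<and>
        u n powr (m + 1) = h * (\<Sum>i=1..<n. w n i * K (real n * h) (real i * h) * u i))"

definition quad_error :: "real \<Rightarrow> (nat \<Rightarrow> nat \<Rightarrow> real) \<Rightarrow> nat \<Rightarrow> (real \<Rightarrow> real) \<Rightarrow> real" where
  "quad_error h w n g =
     integral {0..real n * h} g - h * (\<Sum>i=1..<n. w n i * g (real i * h))"

definition consistency_error ::
  "real \<Rightarrow> (real \<Rightarrow> real \<Rightarrow> real) \<Rightarrow> (real \<Rightarrow> real) \<Rightarrow> (nat \<Rightarrow> nat \<Rightarrow> real) \<Rightarrow> nat \<Rightarrow> real" where
  "consistency_error X K y w N =
     (let h = grid_step X N in
      Max ((\<lambda>n. \<bar>quad_error h w n (\<lambda>t. K (real n * h) t * y t)\<bar>) ` {1..N}))"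

text \<open>
  For \<open>n = 1\<close> the quadrature sum is empty, and the error for \<open>t powr (1/m)\<close> is the whole integral,
  whatever the weights.
\<close>

lemma quad_error_root_first:
  assumes "0 < m" and "0 \<le> h"
  shows "quad_error h w 1 (\<lambda>t. t powr (1/m)) = m / (m + 1) * h powr ((m + 1) / m)"
proof -
  have "((\<lambda>t. t powr (1/m)) has_integral (h powr (1/m + 1) / (1/m + 1))) {0..h}"
    by (rule has_integral_powr_from_0) (use assms in \<open>auto intro: less_trans[of _ 0]\<close>)
  then have "integral {0..h} (\<lambda>t. t powr (1/m)) = h powr (1/m + 1) / (1/m + 1)"
    by (rule integral_unique)
  moreover have "1/m + 1 = (m + 1) / m"
    using assms by (simp add: field_simps)
  ultimately show ?thesis
    by (simp add: quad_error_def)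
qed

text \<open>
  The maximum is therefore taken over the indices \<open>2 \<le> n \<le> N\<close> at which the scheme is applied:
  including \<open>n = 1\<close> would make \<open>E_factor\<close> below nonpositive for every choice of weights.
\<close>

definition root_consistency_error :: "real \<Rightarrow> real \<Rightarrow> (nat \<Rightarrow> nat \<Rightarrow> real) \<Rightarrow> nat \<Rightarrow> real" where
  "root_consistency_error m X w N =
     (let h = grid_step X N in
      Max ((\<lambda>n. \<bar>quad_error h w n (\<lambda>t. t powr (1/m))\<bar>) ` {2..N}))"

definition E_factor :: "real \<Rightarrow> real \<Rightarrow> (nat \<Rightarrow> nat \<Rightarrow> real) \<Rightarrow> nat \<Rightarrow> real" where
  "E_factor m X w N =
     1 - (m + 1) / m * root_consistency_error m X w N * grid_step X N powr (- ((m + 1) / m))"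

end

theory Submission
  imports Defs
begin

text \<open>
  Write \<open>L(x) = (C m x / (m + 1)) powr (1/m)\<close>, the solution of the equation with constant kernel
  \<open>C\<close>. Comparison with this kernel gives \<open>y(x) \<ge> L(x)\<close>: the primitive \<open>F\<close> of \<open>y\<close> satisfies
  \<open>F' \<ge> (C F) powr (1/(m+1))\<close> (\<open>positive_solution_lower_bound\<close>). The same comparison for the scheme
  loses only the error of the quadrature on \<open>t powr (1/m)\<close> and gives \<open>u n \<ge> E L(nh)\<close> for its values \<open>u\<close> by induction
  (\<open>scheme_lower_bound\<close>).

  Subtracting the scheme from the equation, \<open>|y(nh) powr (m+1) - u n powr (m+1)|\<close> is at most
  \<open>\<delta> + h W D (\<Sum>i<n. |e i|)\<close>. To turn this into a bound for \<open>e n\<close>, the difference of powers is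
  bounded from below by \<open>G L(nh) powr m |e n|\<close>. Two values of \<open>G\<close> serve different purposes.

  \<^item> \<open>G = (m + 1) E\<close> produces the exponent of the theorem. By the tangent inequality it needs
    \<open>E L(nh) powr m\<close> as a lower bound for \<open>y(nh) powr m\<close> and for \<open>u n powr m\<close>. For \<open>m > 1\<close> the
    latter does not follow from \<open>u n \<ge> E L(nh)\<close>, as \<open>E powr m \<le> E \<le> 1\<close>. But one further
    application of the scheme extracts an \<open>(m+1)\<close>-st root and thereby improves the bound: it holds
    for all \<open>n \<ge> max 2 m\<close> (\<open>scheme_lower_bound_improved\<close>). The finitely many smaller indices cost a
    constant that depends on \<open>m\<close> only.

  \<^item> \<open>G = 1\<close> is available for every \<open>n\<close>, because the larger of the two numbers is at least
    \<open>y(nh) \<ge> L(nh)\<close>. It keeps all constants uniform when \<open>E\<close> comes close to \<open>0\<close>: the effective exponent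
    \<open>k = k' / max 1 ((m + 1) E)\<close>, with \<open>k' = (m + 1) W D / (m C)\<close>, never exceeds \<open>k'\<close>.

  Since \<open>L(nh) powr m\<close> is proportional to \<open>n h\<close>, the recursion becomes
  \<open>|e n| \<le> (k / n) ((\<Sum>i<n. |e i|) + \<delta> / (h W D))\<close>, and a discrete Gronwall argument
  (\<open>gronwall_one_over_n\<close>) bounds \<open>|e n|\<close> by a multiple of \<open>n powr (k - 1)\<close>. With \<open>n h\<close> near the fixed \<open>x > 0\<close> this
  is of the order of \<open>h powr (1 - k)\<close>, and \<open>k \<le> W D / (m C E)\<close>.
\<close>

section \<open>Inequalities for real powers\<close>

lemma powr_above_tangent:
  fixes p a b :: real
  assumes "1 \<le> p" "0 < a" "0 < b"
  shows "b powr p + p * b powr (p - 1) * (a - b) \<le> a powr p"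
proof -
  have "p * b powr (p - 1) * (a - b) \<le> a powr p - b powr p"
  proof (rule convex_on_imp_above_tangent[where A = "{0<..}" and f = "\<lambda>x. x powr p"])
    show "convex_on {0<..} (\<lambda>x. x powr p)"
      using assms(1) by (intro convex_on_subset[OF powr_convex]) auto
    show "((\<lambda>x. x powr p) has_real_derivative p * b powr (p - 1)) (at b within {0<..})"
      using assms(3) by (auto intro!: derivative_eq_intros)
  qed (use assms in \<open>auto simp: interior_open connected_Ioi\<close>)
  then show ?thesis by (simp add: algebra_simps)
qed

lemma powr_bernoulli:
  fixes p a :: real
  assumes "1 \<le> p" "0 < a"
  shows "1 + p * (a - 1) \<le> a powr p"
  using powr_above_tangent[OF assms, of 1] by simp

text \<open>The convex case, applied to \<open>a powr p\<close> with the exponent \<open>1/p\<close>.\<close>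

lemma powr_bernoulli_concave:
  fixes p a :: real
  assumes "0 < p" "p \<le> 1" "0 < a"
  shows "a powr p \<le> 1 + p * (a - 1)"
proof -
  have "1 + 1 / p * (a powr p - 1) \<le> (a powr p) powr (1 / p)"
    using assms by (intro powr_bernoulli) auto
  also have "\<dots> = a" using assms by (simp add: powr_powr)
  finally show ?thesis using assms by (simp add: field_simps)
qed

text \<open>
  A lower bound on just one of the two numbers suffices, since \<open>max a b powr m\<close> can be factored out
  of the larger power.
\<close>

lemma powr_diff_ge_larger:
  fixes m a b l :: real
  assumes "0 < m" "0 < a" "0 < b" "l \<le> a powr m"
  shows "l * \<bar>a - b\<bar> \<le> \<bar>a powr (m + 1) - b powr (m + 1)\<bar>"
proof -
  have split: "z powr (m + 1) = z * z powr m" if "0 < z" for z :: real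
    using that by (simp add: powr_add mult.commute)
  show ?thesis
  proof (cases "b \<le> a")
    case True
    have "b * b powr m \<le> b * a powr m"
      using True assms by (intro mult_left_mono powr_mono2) auto
    moreover have "l * (a - b) \<le> a * a powr m - b * a powr m"
      using True mult_right_mono[OF assms(4), of "a - b"] by (simp add: algebra_simps)
    ultimately have "l * (a - b) \<le> a * a powr m - b * b powr m" by linarith
    then show ?thesis using True assms by (simp add: split)
  next
    case False
    have "a powr m \<le> b powr m"
      using False assms by (intro powr_mono2) auto
    then have "b * a powr m \<le> b * b powr m" using assms by simp
    moreover have "l * (b - a) \<le> b * a powr m - a * a powr m"
      using False mult_right_mono[OF assms(4), of "b - a"] by (simp add: algebra_simps)
    ultimately have "l * (b - a) \<le> b * b powr m - a * a powr m" by linarith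
    then show ?thesis using False assms by (simp add: split)
  qed
qed

text \<open>
  A lower bound on both numbers gains the factor \<open>m + 1\<close>: the graph of \<open>x powr (m + 1)\<close> lies above
  its tangent at the smaller one.
\<close>

lemma powr_diff_ge_smaller:
  fixes m a b l :: real
  assumes "0 < m" "0 < a" "0 < b" "l \<le> a powr m" "l \<le> b powr m"
  shows "(m + 1) * l * \<bar>a - b\<bar> \<le> \<bar>a powr (m + 1) - b powr (m + 1)\<bar>"
  using assms(2-)
proof (induction a b rule: linorder_wlog)
  case (le a b)
  have "(m + 1) * l * (b - a) \<le> (m + 1) * a powr m * (b - a)"
    using le assms(1) by (intro mult_right_mono mult_left_mono) auto
  also have "\<dots> \<le> b powr (m + 1) - a powr (m + 1)"
    using powr_above_tangent[of "m + 1" b a] le assms(1) by simp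
  finally show ?case using le by simp
next
  case (sym a b)
  then show ?case by (simp add: abs_minus_commute)
qed

text \<open>
  Serves the lower bounds for the scheme twice: with \<open>q = m\<close> to preserve the factor \<open>E\<close> in the
  induction, and with \<open>q = 1/m\<close> to improve it afterwards.
\<close>

lemma powr_le_convex_combination:
  fixes q r E :: real
  assumes "0 < q" "0 < E" "E \<le> 1" "r \<le> 1" "r \<le> q"
  shows "E powr q \<le> 1 - (1 - E) * r"
proof -
  have r1: "(1 - E) * r \<le> 1 - E" and rq: "(1 - E) * r \<le> (1 - E) * q"
    using assms by (auto intro: mult_left_mono simp: mult_left_le)
  show ?thesis
  proof (cases "q \<le> 1")
    case True
    then show ?thesis
      using powr_bernoulli_concave[of q E] assms rq by (simp add: algebra_simps)
  next
    case False
    then have "E powr q \<le> E powr 1" using assms by (intro powr_mono') auto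
    then show ?thesis using assms r1 by simp
  qed
qed

text \<open>
  Absorbs powers of a grid point into a constant although the exponent varies with the grid: the
  extreme exponents \<open>k\<close> and \<open>- 1\<close> are the worst ones for \<open>z \<ge> 1\<close> and \<open>z < 1\<close>.
\<close>

lemma powr_le_between:
  fixes z s k a b :: real
  assumes "0 < a" "a \<le> z" "z \<le> b" "- 1 \<le> s" "s \<le> k" "0 \<le> k"
  shows "z powr s \<le> (1 + b) powr k + 1 / a"
proof (cases "1 \<le> z")
  case True
  have "z powr s \<le> z powr k" using True assms by (intro powr_mono) auto
  also have "\<dots> \<le> (1 + b) powr k" using assms by (intro powr_mono2) auto
  finally show ?thesis using assms by (simp add: add_increasing2)
next
  case False
  have "z powr s \<le> z powr (- 1)" using False assms by (intro powr_mono') auto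
  also have "\<dots> \<le> 1 / a" using assms by (simp add: powr_minus divide_simps)
  finally show ?thesis by (simp add: add_increasing)
qed

section \<open>Lower bounds for the solution and for the scheme\<close>

text \<open>
  For \<open>F x = integral {0..x} y\<close> the equation gives \<open>C F \<le> y powr (m+1)\<close>, that is,
  \<open>F' \<ge> (C F) powr (1/(m+1))\<close>. Separating variables, \<open>F powr (m/(m+1))\<close> has derivative at least
  \<open>m/(m+1) * C powr (1/(m+1))\<close>, and integration from \<open>0\<close> gives the claim. The division by a power of
  \<open>F\<close> is legitimate because \<open>y powr (m+1) \<le> D F\<close> makes \<open>F\<close> positive on \<open>(0, X]\<close>.
\<close>

lemma positive_solution_lower_bound:
  fixes m X C D x :: real
  assumes m: "0 < m" and C: "0 < C"
    and K: "continuous_on ({0..X} \<times> {0..X}) (\<lambda>(x, t). K x t)"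
    and KCD: "\<forall>x\<in>{0..X}. \<forall>t\<in>{0..X}. C \<le> K x t \<and> K x t \<le> D"
    and sol: "positive_solution m X K y"
    and x: "x \<in> {0<..X}"
  shows "C * (m / (m + 1)) * x \<le> y x powr m"
proof -
  define q where "q = m / (m + 1)"
  have q: "0 < q" "q < 1" using m by (auto simp: q_def)
  define F where "F = (\<lambda>z. integral {0..z} y)"
  have cont: "continuous_on {0..X} y"
    and pos: "\<And>z. z \<in> {0<..X} \<Longrightarrow> 0 < y z"
    and eq: "\<And>z. z \<in> {0..X} \<Longrightarrow> y z powr (m + 1) = integral {0..z} (\<lambda>t. K z t * y t)"
    using sol by (auto simp: positive_solution_def)
  have y0: "y 0 = 0"
    using eq[of 0] x m by simp
  have nonneg: "0 \<le> y z" if "z \<in> {0..X}" for z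
    using pos[of z] y0 that by (cases "z = 0") auto
  have sandwich: "C * F z \<le> y z powr (m + 1) \<and> y z powr (m + 1) \<le> D * F z"
    if z: "z \<in> {0..X}" for z
  proof -
    have cy: "continuous_on {0..z} y"
      using cont z by (auto intro: continuous_on_subset)
    have "continuous_on {0..z} (\<lambda>t. (\<lambda>(x, t). K x t) (z, t))"
      using z by (intro continuous_on_compose2[OF K]) (auto intro!: continuous_intros)
    then have cK: "continuous_on {0..z} (\<lambda>t. K z t * y t)"
      using cy by (auto intro!: continuous_intros)
    have le: "C * y t \<le> K z t * y t" "K z t * y t \<le> D * y t" if "t \<in> {0..z}" for t
      using KCD z that nonneg[of t] by (auto intro!: mult_right_mono)
    have "integral {0..z} (\<lambda>t. C * y t) \<le> integral {0..z} (\<lambda>t. K z t * y t)"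
      using le by (intro integral_le integrable_continuous_interval cK continuous_on_mult_left cy) auto
    moreover have "integral {0..z} (\<lambda>t. K z t * y t) \<le> integral {0..z} (\<lambda>t. D * y t)"
      using le by (intro integral_le integrable_continuous_interval cK continuous_on_mult_left cy) auto
    ultimately show ?thesis using eq[OF z] by (simp add: F_def)
  qed
  have D: "0 < D" using KCD C x by force
  have Fpos: "0 < F z" if "z \<in> {0<..X}" for z
  proof -
    have "0 < D * F z" using sandwich[of z] pos[OF that] that
      by (auto intro: less_le_trans[of 0 "y z powr (m + 1)"])
    then show ?thesis using D by (simp add: zero_less_mult_iff)
  qed
  have F0: "F 0 = 0" by (simp add: F_def)
  have dF: "(F has_real_derivative y z) (at z)" if "z \<in> {0<..<X}" for z
  proof -
    have "(F has_real_derivative y z) (at z within {0..X})"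
      unfolding F_def using cont that by (intro integral_has_real_derivative) auto
    then show ?thesis using that by (simp add: at_within_Icc_at)
  qed
  have cF: "continuous_on {0..X} F"
    unfolding F_def using cont by (intro indefinite_integral_continuous_1 integrable_continuous_interval)
  define G where "G = (\<lambda>z. F z powr q - q * C powr (1 / (m + 1)) * z)"
  have "G 0 \<le> G x"
  proof (rule DERIV_nonneg_imp_increasing_open[of 0 x G])
    fix z assume z: "0 < z" "z < x"
    then have zX: "z \<in> {0<..<X}" using x by auto
    have d: "(G has_real_derivative q * F z powr (q - 1) * y z - q * C powr (1 / (m + 1))) (at z)"
      unfolding G_def using dF[OF zX] Fpos[of z] zX
      by (auto intro!: derivative_eq_intros)
    have "(C * F z) powr (1 / (m + 1)) \<le> (y z powr (m + 1)) powr (1 / (m + 1))"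
      using sandwich[of z] Fpos[of z] zX C m by (intro powr_mono2) auto
    also have "\<dots> = y z" using m pos[of z] zX by (simp add: powr_powr)
    finally have "C powr (1 / (m + 1)) * F z powr (1 / (m + 1)) \<le> y z"
      using C Fpos[of z] zX by (simp add: powr_mult)
    moreover have "1 / (m + 1) = 1 - q" using m by (simp add: q_def field_simps)
    ultimately have "F z powr (q - 1) * (C powr (1 / (m + 1)) * F z powr (1 - q))
        \<le> F z powr (q - 1) * y z"
      by (intro mult_left_mono) auto
    moreover have "F z powr (q - 1) * F z powr (1 - q) = 1"
      using Fpos[of z] zX by (simp flip: powr_add)
    ultimately have "C powr (1 / (m + 1)) \<le> F z powr (q - 1) * y z"
      by (metis mult.left_commute mult.right_neutral)
    then have "0 \<le> q * F z powr (q - 1) * y z - q * C powr (1 / (m + 1))"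
      using q by (simp add: mult.assoc)
    with d show "\<exists>D'. (G has_real_derivative D') (at z) \<and> 0 \<le> D'" by blast
  next
    show "continuous_on {0..x} G"
    proof -
      have "continuous_on {0..x} F" using x by (intro continuous_on_subset[OF cF]) auto
      moreover have "0 \<le> F z" if "z \<in> {0..x}" for z
        using Fpos[of z] F0 that x by (cases "z = 0") auto
      ultimately show ?thesis
        unfolding G_def using q by (intro continuous_intros continuous_on_powr') auto
    qed
  qed (use x in auto)
  then have "q * C powr (1 / (m + 1)) * x \<le> F x powr q"
    using F0 q by (simp add: G_def)
  then have "C powr q * (q * C powr (1 / (m + 1)) * x) \<le> C powr q * F x powr q"
    by (intro mult_left_mono) auto
  also have "\<dots> = (C * F x) powr q" using C Fpos[OF x] by (simp add: powr_mult)
  also have "\<dots> \<le> (y x powr (m + 1)) powr q"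
    using sandwich[of x] x q Fpos[OF x] C by (intro powr_mono2) auto
  also have "\<dots> = y x powr m" using m by (simp add: powr_powr q_def)
  finally have "C powr q * C powr (1 / (m + 1)) * (q * x) \<le> y x powr m"
    by (simp add: algebra_simps)
  moreover have "C powr q * C powr (1 / (m + 1)) = C"
    using C m by (simp add: q_def flip: powr_add add_divide_distrib)
  ultimately show ?thesis by (simp add: q_def algebra_simps)
qed

text \<open>
  The powers \<open>(c x) powr (1/m)\<close> with \<open>c = C m/(m+1)\<close> reproduce themselves: integrating over
  \<open>[0, x]\<close> and multiplying by \<open>C\<close> gives \<open>(c x) powr (1 + 1/m)\<close>. One application of the scheme to
  a multiple of this profile therefore changes it only by the relative quadrature error.
\<close>

lemma scheme_step_lower_bound:
  fixes m C h A \<epsilon> v :: real and n :: nat and wt u :: "nat \<Rightarrow> real"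
  assumes m: "0 < m" and C: "0 < C" and h: "0 < h" and n: "1 \<le> n" and A: "0 \<le> A"
    and quad: "m / (m + 1) * (n * h) powr ((m + 1) / m) - \<epsilon>
                 \<le> h * (\<Sum>i=1..<n. wt i * (i * h) powr (1 / m))"
    and wt: "\<And>i. i \<in> {1..<n} \<Longrightarrow> 0 \<le> wt i"
    and u: "\<And>i. i \<in> {1..<n} \<Longrightarrow> A * (C * (m / (m + 1)) * (i * h)) powr (1 / m) \<le> u i"
    and v: "C * (h * (\<Sum>i=1..<n. wt i * u i)) \<le> v"
  shows "A * (1 - (m + 1) / m * \<epsilon> * (n * h) powr (- ((m + 1) / m)))
           * (C * (m / (m + 1)) * (n * h)) powr ((m + 1) / m) \<le> v"
proof -
  define c where "c = C * (m / (m + 1))"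
  define z where "z = real n * h"
  define q where "q = (m + 1) / m"
  have pos: "0 < c" "0 < z" "0 < q" "0 < m / (m + 1)"
    using m C h n by (auto simp: c_def z_def q_def)
  have q: "q = 1 + 1 / m" using m by (simp add: q_def field_simps)
  have C_eq: "C = c * q" using m by (simp add: c_def q_def)
  have mq: "m / (m + 1) = 1 / q" by (simp add: q_def)
  have zz: "z powr q * z powr (- q) = 1" using pos by (simp flip: powr_add)
  have "A * (1 - q * \<epsilon> * z powr (- q)) * (c * z) powr q
      = A * c powr q * (z powr q - q * \<epsilon> * (z powr q * z powr (- q)))"
    using pos by (simp add: powr_mult algebra_simps)
  also have "\<dots> = A * c powr q * (z powr q - q * \<epsilon>)"
    by (simp add: zz)
  also have "\<dots> = C * (A * c powr (1 / m) * (1 / q * z powr q - \<epsilon>))"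
    using pos by (simp add: q C_eq powr_add field_simps)
  also have "\<dots> \<le> C * (A * c powr (1 / m) * (h * (\<Sum>i=1..<n. wt i * (i * h) powr (1 / m))))"
    using quad C A by (intro mult_left_mono) (auto simp: mq q_def[symmetric] z_def)
  also have "\<dots> = C * (h * (\<Sum>i=1..<n. wt i * (A * (c * (i * h)) powr (1 / m))))"
    using pos h by (simp add: powr_mult sum_distrib_left mult_ac)
  also have "\<dots> \<le> C * (h * (\<Sum>i=1..<n. wt i * u i))"
    using C h wt u by (intro mult_left_mono sum_mono) (auto simp: c_def)
  also have "\<dots> \<le> v" by (rule v)
  finally show ?thesis by (simp add: c_def z_def q_def)
qed

text \<open>
  Let \<open>L n = C m/(m+1) n h\<close>. The relative quadrature error at the index \<open>n\<close> is at most \<open>(1 - E) r n\<close> with \<open>r n = n powr (-(1 + 1/m))\<close>, so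
  the step from \<open>u i \<ge> E L i powr (1/m)\<close> for \<open>i < n\<close> gives
  \<open>u n powr (m+1) \<ge> E (1 - (1 - E) r n) L n powr (1 + 1/m)\<close>. The induction closes because the middle
  factor is at least \<open>E powr m\<close>. For \<open>n \<ge> m\<close> it is also at least \<open>E powr (1/m)\<close>, and raising to the power
  \<open>m/(m+1)\<close> gives the second bound, which for \<open>m > 1\<close> is the stronger one.
\<close>

lemma scheme_lower_bounds:
  fixes m C h \<epsilon> E :: real and N :: nat
    and wt :: "nat \<Rightarrow> nat \<Rightarrow> real" and u :: "nat \<Rightarrow> real"
  assumes m: "0 < m" and C: "0 < C" and h: "0 < h"
    and E_def: "E = 1 - (m + 1) / m * \<epsilon> * h powr (- ((m + 1) / m))"
    and E: "0 < E" "E \<le> 1"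
    and quad: "\<And>n. n \<in> {2..N} \<Longrightarrow> m / (m + 1) * (n * h) powr ((m + 1) / m) - \<epsilon>
                 \<le> h * (\<Sum>i=1..<n. wt n i * (i * h) powr (1 / m))"
    and wt: "\<And>n i. n \<in> {2..N} \<Longrightarrow> i \<in> {1..<n} \<Longrightarrow> 0 \<le> wt n i"
    and u0: "\<And>n. n \<in> {2..N} \<Longrightarrow> 0 \<le> u n"
    and u: "\<And>n. n \<in> {2..N} \<Longrightarrow> C * (h * (\<Sum>i=1..<n. wt n i * u i)) \<le> u n powr (m + 1)"
    and u1: "E * (C * (m / (m + 1)) * h) powr (1 / m) \<le> u 1"
  shows scheme_lower_bound:
      "n \<in> {1..N} \<Longrightarrow> E * (C * (m / (m + 1)) * (n * h)) powr (1 / m) \<le> u n"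
    and scheme_lower_bound_improved:
      "n \<in> {2..N} \<Longrightarrow> m \<le> n \<Longrightarrow> E * (C * (m / (m + 1)) * (n * h)) \<le> u n powr m"
proof -
  define q where "q = (m + 1) / m"
  have q: "q = 1 + 1 / m" using m by (simp add: q_def field_simps)
  define L where "L = (\<lambda>n. C * (m / (m + 1)) * (real n * h))"
  have L: "0 < L n" if "1 \<le> n" for n using that m C h by (simp add: L_def)
  define r where "r = (\<lambda>n. real n powr (- q))"
  have r1: "r n \<le> 1" if "2 \<le> n" for n
    using that m powr_mono[of "- q" 0 "real n"] by (simp add: r_def q_def)
  \<comment> \<open>For small \<open>m\<close> this rests on \<open>2 powr t \<ge> t\<close> at \<open>t = 1/m\<close>.\<close>
  have rm: "r n \<le> m" if n: "2 \<le> n" for n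
  proof (cases "1 \<le> m")
    case False
    have "1 / m \<le> 2 powr (1 / m)"
      using powr_bernoulli[of "1 / m" 2] m False by simp
    also have "\<dots> \<le> real n powr (1 / m)" using n m by (intro powr_mono2) auto
    also have "\<dots> \<le> real n powr q" using n m by (intro powr_mono) (auto simp: q)
    finally show ?thesis using m n by (simp add: r_def powr_minus field_simps)
  qed (use r1[OF n] in simp)
  have rinv: "r n \<le> 1 / m" if "2 \<le> n" "m \<le> n" for n
  proof -
    have "real n powr 1 \<le> real n powr q" using that m by (intro powr_mono) (auto simp: q)
    then have "m \<le> real n powr q" using that by simp
    then show ?thesis using that m by (simp add: r_def powr_minus field_simps)
  qed
  have step: "E * (1 - (1 - E) * r n) * L n powr q \<le> u n powr (m + 1)"
    if n: "n \<in> {2..N}" and IH: "\<And>i. i \<in> {1..<n} \<Longrightarrow> E * L i powr (1 / m) \<le> u i" for n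
  proof -
    have "E * (1 - q * \<epsilon> * (n * h) powr (- q)) * L n powr q \<le> u n powr (m + 1)"
      unfolding L_def q_def
      by (rule scheme_step_lower_bound[OF m C h _ _ quad[OF n] wt[OF n] _ u[OF n]])
         (use n E IH in \<open>auto simp: L_def\<close>)
    moreover have "q * \<epsilon> * (n * h) powr (- q) = (1 - E) * r n"
      using h by (simp add: E_def r_def powr_mult flip: q_def)
    ultimately show ?thesis by simp
  qed
  have lower: "E * L n powr (1 / m) \<le> u n" if "n \<in> {1..N}" for n
    using that
  proof (induction n rule: less_induct)
    case (less n)
    show ?case
    proof (cases "n = 1")
      case True
      then show ?thesis using u1 by (simp add: L_def)
    next
      case False
      then have n: "n \<in> {2..N}" using less.prems by auto
      have "(E * L n powr (1 / m)) powr (m + 1) = E powr (m + 1) * L n powr q"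
        using E L[of n] n m by (simp add: powr_mult powr_powr q_def)
      also have "\<dots> = E * E powr m * L n powr q"
        using E by (simp add: powr_add)
      also have "\<dots> \<le> E * (1 - (1 - E) * r n) * L n powr q"
        using E m n r1[of n] rm[of n]
        by (intro mult_right_mono mult_left_mono powr_le_convex_combination) auto
      also have "\<dots> \<le> u n powr (m + 1)"
        using n less by (intro step) auto
      finally have "(E * L n powr (1 / m)) powr (m + 1) \<le> u n powr (m + 1)" .
      then show ?thesis
        using powr_less_mono2[of "m + 1" "u n" "E * L n powr (1 / m)"] m u0[OF n] by force
    qed
  qed
  show "n \<in> {1..N} \<Longrightarrow> E * (C * (m / (m + 1)) * (n * h)) powr (1 / m) \<le> u n"
    using lower[of n] by (simp add: L_def)
  assume n: "n \<in> {2..N}" "m \<le> n"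
  have "E powr q * L n powr q = E * E powr (1 / m) * L n powr q"
    using E by (simp add: q powr_add)
  also have "\<dots> \<le> E * (1 - (1 - E) * r n) * L n powr q"
    using E m n r1[of n] rinv[of n]
    by (intro mult_right_mono mult_left_mono powr_le_convex_combination) auto
  also have "\<dots> \<le> u n powr (m + 1)"
    using n lower by (intro step) auto
  finally have le: "E powr q * L n powr q \<le> u n powr (m + 1)" .
  have "E * L n = (E powr q * L n powr q) powr (1 / q)"
    using E L[of n] n m by (simp add: powr_mult powr_powr q_def)
  also have "\<dots> \<le> (u n powr (m + 1)) powr (1 / q)"
    using le m E by (intro powr_mono2) (auto simp: q_def)
  also have "\<dots> = u n powr m" using m by (simp add: powr_powr q_def)
  finally show "E * (C * (m / (m + 1)) * (n * h)) \<le> u n powr m" by (simp add: L_def)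
qed

section \<open>A discrete Gronwall inequality\<close>

text \<open>
  The accumulated quantity \<open>U n = (\<Sum>i=1..<n. a i) + b\<close> grows at most by the factor \<open>1 + k/n\<close> in each
  step, and the product of these factors is of the order of \<open>n powr k\<close>. The \<open>M\<close> initial steps, for
  which only the larger rate \<open>k'\<close> is known, enter as a constant factor.
\<close>

lemma gronwall_one_over_n:
  fixes a :: "nat \<Rightarrow> real" and b k k' :: real
  assumes a: "\<And>n. 0 \<le> a n" and b: "0 \<le> b" and k: "0 \<le> k" "k \<le> k'"
    and crude: "\<And>n. n \<in> {2..N} \<Longrightarrow> a n \<le> k' / n * ((\<Sum>i=1..<n. a i) + b)"
    and sharp: "\<And>n. n \<in> {2..N} \<Longrightarrow> M \<le> n \<Longrightarrow> a n \<le> k / n * ((\<Sum>i=1..<n. a i) + b)"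
    and n: "n \<in> {2..N}"
  shows "a n \<le> k' * (1 + k') ^ M * (a 1 + b) * real n powr (k - 1)"
proof -
  define U where "U = (\<lambda>n. (\<Sum>i=1..<n. a i) + b)"
  have U0: "0 \<le> U n" for n using a b by (auto simp: U_def intro!: add_nonneg_nonneg sum_nonneg)
  have U_Suc: "U (Suc j) = U j + a j" if "2 \<le> j" for j
    using that by (simp add: U_def)
  have main: "U j \<le> (1 + k') ^ min j M * (a 1 + b) * (real j - 1) powr k"
    if "2 \<le> j" "j \<le> N" for j
    using that
  proof (induction j rule: dec_induct)
    case base
    have "{1..<2::nat} = {1}" by auto
    then have "U 2 = a 1 + b" by (simp add: U_def)
    moreover have "1 * (a 1 + b) \<le> (1 + k') ^ min 2 M * (a 1 + b)"
      using k a[of 1] b by (intro mult_right_mono one_le_power) auto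
    ultimately show ?case by simp
  next
    case (step j)
    let ?B = "(1 + k') ^ min j M * (a 1 + b)"
    have B: "0 \<le> ?B" using k a[of 1] b by simp
    have IH: "U j \<le> ?B * (real j - 1) powr k" using step by simp
    have jN: "j \<in> {2..N}" using step by auto
    show ?case
    proof (cases "M \<le> j")
      case True
      \<comment> \<open>\<open>1 + k/j \<le> exp (1/j) powr k \<le> (j/(j-1)) powr k\<close>, so the factors telescope. The detour over
        \<open>exp\<close> covers \<open>0 < k < 1\<close>, where \<open>1 + k/j\<close> exceeds \<open>((j+1)/j) powr k\<close>.\<close>
      have "1 + k / j \<le> exp (k / j)" by (rule exp_ge_add_one_self)
      also have "exp (k / j) = exp (1 / j) powr k" by (simp add: powr_def)
      also have "\<dots> \<le> (real j / (real j - 1)) powr k"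
      proof (intro powr_mono2)
        have "1 - 1 / real j \<le> exp (- (1 / real j))"
          using exp_ge_add_one_self[of "- (1 / real j)"] by simp
        then have "exp (1 / j) * (1 - 1 / real j) \<le> exp (1 / j) * exp (- (1 / real j))"
          by (intro mult_left_mono) auto
        also have "\<dots> = 1" by (simp flip: exp_add)
        finally show "exp (1 / j) \<le> real j / (real j - 1)"
          using step by (simp add: field_simps)
      qed (use k in auto)
      finally have grow: "(1 + k / j) * (real j - 1) powr k \<le> real j powr k"
        using step by (simp add: powr_divide field_simps)
      have "U (Suc j) \<le> (1 + k / j) * U j"
        using U_Suc[of j] sharp[OF jN True] step by (simp add: U_def algebra_simps)
      also have "\<dots> \<le> (1 + k / j) * (?B * (real j - 1) powr k)"
        using IH k by (intro mult_left_mono) auto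
      also have "\<dots> = ?B * ((1 + k / j) * (real j - 1) powr k)" by simp
      also have "\<dots> \<le> ?B * real j powr k"
        using grow B by (intro mult_left_mono)
      finally show ?thesis using True by (cases "j = M") (auto simp: min_def)
    next
      case False
      have kj: "k' / j \<le> k'" using k step by (simp add: divide_le_eq mult_le_cancel_left1)
      have "U (Suc j) \<le> (1 + k' / j) * U j"
        using U_Suc[of j] crude[OF jN] step by (simp add: U_def algebra_simps)
      also have "\<dots> \<le> (1 + k') * U j"
        using kj U0 by (intro mult_right_mono) auto
      also have "\<dots> \<le> (1 + k') * (?B * (real j - 1) powr k)"
        using IH k by (intro mult_left_mono) auto
      also have "\<dots> \<le> (1 + k') * (?B * real j powr k)"
        using k B step by (intro mult_left_mono powr_mono2) auto
      also have "\<dots> = (1 + k') ^ min (Suc j) M * (a 1 + b) * (real (Suc j) - 1) powr k"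
        using False by (simp add: min_def)
      finally show ?thesis .
    qed
  qed
  have nn: "2 \<le> n" "n \<le> N" using n by auto
  have "U n \<le> (1 + k') ^ min n M * (a 1 + b) * (real n - 1) powr k"
    using main[OF nn] .
  also have "\<dots> \<le> (1 + k') ^ M * (a 1 + b) * real n powr k"
    using k a[of 1] b nn by (intro mult_mono power_increasing powr_mono2) auto
  finally have "a n \<le> k' / n * ((1 + k') ^ M * (a 1 + b) * real n powr k)"
    using crude[OF n] k nn
    by (intro order_trans[OF crude[OF n]] mult_left_mono) (auto simp: U_def)
  also have "\<dots> = k' * (1 + k') ^ M * (a 1 + b) * real n powr (k - 1)"
    using nn by (simp add: powr_diff)
  finally show ?thesis .
qed

section \<open>The error on a fixed grid\<close>

lemma abs_quad_error_le_consistency_error: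
  assumes "n \<in> {1..N}"
  shows "\<bar>quad_error (grid_step X N) w n (\<lambda>t. K (n * grid_step X N) t * y t)\<bar>
           \<le> consistency_error X K y w N"
  using assms by (auto simp: consistency_error_def Let_def intro!: Max_ge)

lemma abs_quad_error_le_root_consistency_error:
  assumes "n \<in> {2..N}"
  shows "\<bar>quad_error (grid_step X N) w n (\<lambda>t. t powr (1/m))\<bar> \<le> root_consistency_error m X w N"
  using assms by (auto simp: root_consistency_error_def Let_def intro!: Max_ge)

lemma quadrature_of_root_lower_bound:
  fixes m X h :: real and n N :: nat
  assumes "0 < m" "0 < X" "n \<in> {2..N}"
  defines "h \<equiv> grid_step X N"
  shows "m / (m + 1) * (n * h) powr ((m + 1) / m) - root_consistency_error m X w N
           \<le> h * (\<Sum>i=1..<n. w n i * (i * h) powr (1 / m))"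
proof -
  have "0 \<le> n * h" using assms by (simp add: grid_step_def)
  then have "((\<lambda>t. t powr (1/m)) has_integral ((n * h) powr (1/m + 1) / (1/m + 1))) {0..n * h}"
    by (intro has_integral_powr_from_0) (use assms(1) in \<open>auto intro: less_trans[of _ 0]\<close>)
  moreover have "1/m + 1 = (m + 1) / m"
    using assms(1) by (simp add: field_simps)
  ultimately have "integral {0..n * h} (\<lambda>t. t powr (1/m)) = m / (m + 1) * (n * h) powr ((m + 1) / m)"
    by (simp add: integral_unique)
  then show ?thesis
    using abs_quad_error_le_root_consistency_error[OF assms(3), of X w m]
    by (simp add: quad_error_def h_def)
qed

lemma root_consistency_error_nonneg:
  assumes "2 \<le> N"
  shows "0 \<le> root_consistency_error m X w N"
  using abs_quad_error_le_root_consistency_error[of 2 N X w m] assms by force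

lemma E_factor_le_1:
  assumes "0 < m" "2 \<le> N"
  shows "E_factor m X w N \<le> 1"
  using root_consistency_error_nonneg[OF assms(2), of m X w] assms(1) by (simp add: E_factor_def)

text \<open>
  The bound on one grid, with constants that depend neither on the grid nor on \<open>E\<close>. The initial
  steps of the Gronwall inequality are those with \<open>n < m\<close>, where the improved lower bound for the
  scheme may fail.
\<close>

lemma scheme_error_bound:
  fixes m X C D W h E k' :: real and N n :: nat
    and w :: "nat \<Rightarrow> nat \<Rightarrow> real" and u :: "nat \<Rightarrow> real"
  assumes m: "0 < m" and X: "0 < X" and C: "0 < C" and W: "0 < W"
    and K: "continuous_on ({0..X} \<times> {0..X}) (\<lambda>(x, t). K x t)"
    and KCD: "\<forall>x\<in>{0..X}. \<forall>t\<in>{0..X}. C \<le> K x t \<and> K x t \<le> D"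
    and sol: "positive_solution m X K y"
    and w: "\<forall>n\<in>{2..N}. \<forall>i\<in>{1..<n}. 0 < w n i \<and> w n i \<le> W"
    and scheme: "explicit_scheme m X K w N u"
    and n: "n \<in> {2..N}"
  defines "h \<equiv> grid_step X N"
    and "E \<equiv> E_factor m X w N"
  assumes E: "0 < E"
    and u1: "E * (C * (m / (m + 1)) * h) powr (1 / m) \<le> u 1"
  defines "k' \<equiv> (m + 1) / m * (W * D / C)"
  shows "\<bar>y (n * h) - u n\<bar>
    \<le> k' * (1 + k') ^ nat \<lceil>m\<rceil> * (\<bar>y h - u 1\<bar> + consistency_error X K y w N / (h * W * D))
         * real n powr (k' / max 1 ((m + 1) * E) - 1)"
proof -
  define a where "a = (\<lambda>n. \<bar>y (real n * h) - u n\<bar>)"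
  define \<delta> where "\<delta> = consistency_error X K y w N"
  define lev where "lev = (\<lambda>n. C * (m / (m + 1)) * (real n * h))"
  define G where "G = max 1 ((m + 1) * E)"
  have N: "2 \<le> N" using n by simp
  have h: "0 < h" using X N by (simp add: h_def grid_step_def)
  have grid: "real j * h \<in> {0<..X}" if "j \<in> {1..N}" for j
  proof -
    have "real j * h \<le> real N * h" using that h by (intro mult_right_mono) auto
    also have "\<dots> = X" using N by (simp add: h_def grid_step_def)
    finally show ?thesis using that h by simp
  qed
  have D: "0 < D" using KCD C X by (force intro: less_le_trans[of 0 C])
  have E1: "E \<le> 1" unfolding E_def using m N by (rule E_factor_le_1)
  have ypos: "0 < y (j * h)" if "j \<in> {1..N}" for j
    using sol grid[OF that] by (simp add: positive_solution_def)
  have y_low: "lev j \<le> y (j * h) powr m" if "j \<in> {1..N}" for j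
    using positive_solution_lower_bound[OF m C K KCD sol grid[OF that]] by (simp add: lev_def)
  have levpos: "0 < lev j" if "1 \<le> j" for j using that m C h by (simp add: lev_def)
  have u_eq: "u j powr (m + 1) = h * (\<Sum>i=1..<j. w j i * K (j * h) (i * h) * u i)"
    and u_ge: "0 \<le> u j" if "j \<in> {2..N}" for j
    using scheme that by (auto simp: explicit_scheme_def Let_def h_def)
  have "0 < E * (C * (m / (m + 1)) * h) powr (1 / m)" using E m C h by simp
  then have u1pos: "0 < u 1" using u1 by linarith
  have u_nonneg: "0 \<le> u j" if "j \<in> {1..N}" for j
    using that u_ge[of j] u1pos by (cases "j = 1") auto
  have u_sum: "C * (h * (\<Sum>i=1..<j. w j i * u i)) \<le> u j powr (m + 1)" if j: "j \<in> {2..N}" for j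
  proof -
    have "C * (h * (\<Sum>i=1..<j. w j i * u i)) = h * (\<Sum>i=1..<j. w j i * C * u i)"
      by (simp add: sum_distrib_left mult_ac)
    also have "\<dots> \<le> h * (\<Sum>i=1..<j. w j i * K (j * h) (i * h) * u i)"
    proof (intro mult_left_mono sum_mono mult_right_mono)
      fix i assume i: "i \<in> {1..<j}"
      show "C \<le> K (j * h) (i * h)" using KCD grid[of i] grid[of j] i j by auto
      show "0 \<le> w j i" using w i j by (force intro: less_imp_le)
      show "0 \<le> u i" using u_nonneg[of i] i j by auto
    qed (use h in auto)
    finally show ?thesis using u_eq[OF j] by simp
  qed
  have E_eq: "E = 1 - (m + 1) / m * root_consistency_error m X w N * h powr (- ((m + 1) / m))"
    by (simp add: E_def E_factor_def h_def)
  have quad: "m / (m + 1) * (j * h) powr ((m + 1) / m) - root_consistency_error m X w N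
      \<le> h * (\<Sum>i=1..<j. w j i * (i * h) powr (1 / m))" if "j \<in> {2..N}" for j
    using quadrature_of_root_lower_bound[OF m X that] by (simp add: h_def)
  have w0: "0 \<le> w j i" if "j \<in> {2..N}" "i \<in> {1..<j}" for j i
    using w that by (force intro: less_imp_le)
  note bounds = scheme_lower_bounds[OF m C h E_eq E E1 quad w0 u_ge u_sum u1]
  have upos: "0 < u j" if "j \<in> {1..N}" for j
  proof -
    have "0 < E * lev j powr (1 / m)" using E levpos[of j] that by simp
    then show ?thesis using bounds(1)[OF _ _ _ _ _ that] by (simp add: lev_def)
  qed
  \<comment> \<open>Equation minus scheme: the local error of the quadrature plus the propagated errors.\<close>
  have residual: "\<bar>y (j * h) powr (m + 1) - u j powr (m + 1)\<bar> \<le> \<delta> + h * W * D * (\<Sum>i=1..<j. a i)"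
    if j: "j \<in> {2..N}" for j
  proof -
    have "y (j * h) powr (m + 1) = integral {0..j * h} (\<lambda>t. K (j * h) t * y t)"
      using sol grid[of j] j by (simp add: positive_solution_def)
    then have "y (j * h) powr (m + 1) - u j powr (m + 1)
      = quad_error h w j (\<lambda>t. K (j * h) t * y t)
        + h * (\<Sum>i=1..<j. w j i * K (j * h) (i * h) * (y (i * h) - u i))"
      using u_eq[OF j]
      by (simp add: quad_error_def right_diff_distrib sum_subtractf mult.assoc)
    moreover have "\<bar>quad_error h w j (\<lambda>t. K (j * h) t * y t)\<bar> \<le> \<delta>"
      unfolding h_def \<delta>_def using j by (intro abs_quad_error_le_consistency_error) auto
    moreover have "\<bar>\<Sum>i=1..<j. w j i * K (j * h) (i * h) * (y (i * h) - u i)\<bar> \<le> (\<Sum>i=1..<j. W * D * a i)"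
    proof (rule order_trans[OF sum_abs], rule sum_mono)
      fix i assume i: "i \<in> {1..<j}"
      have "0 < w j i" "w j i \<le> W" using w i j by auto
      moreover have "C \<le> K (j * h) (i * h)" "K (j * h) (i * h) \<le> D"
        using KCD grid[of i] grid[of j] i j by auto
      ultimately have "\<bar>w j i * K (j * h) (i * h)\<bar> \<le> W * D"
        using C W by (auto simp: abs_mult intro!: mult_mono)
      then show "\<bar>w j i * K (j * h) (i * h) * (y (i * h) - u i)\<bar> \<le> W * D * a i"
        unfolding abs_mult[of "w j i * K (j * h) (i * h)"] a_def by (intro mult_right_mono) auto
    qed
    then have "h * \<bar>\<Sum>i=1..<j. w j i * K (j * h) (i * h) * (y (i * h) - u i)\<bar>
        \<le> h * (W * D * (\<Sum>i=1..<j. a i))"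
      using h by (intro mult_left_mono) (auto simp: sum_distrib_left)
    then have "\<bar>h * (\<Sum>i=1..<j. w j i * K (j * h) (i * h) * (y (i * h) - u i))\<bar>
        \<le> h * W * D * (\<Sum>i=1..<j. a i)"
      using h by (simp add: abs_mult mult.assoc)
    ultimately show ?thesis by linarith
  qed
  \<comment> \<open>\<open>lev j\<close> is proportional to \<open>j h\<close>, so dividing by it cancels the \<open>h\<close> before the sum and leaves
    the factor \<open>1/j\<close>. Pulling out \<open>h W D\<close> makes the offset in the bracket independent of \<open>g\<close>.\<close>
  have solve: "a j \<le> k' / g / j * ((\<Sum>i=1..<j. a i) + \<delta> / (h * W * D))"
    if g: "0 < g" and j: "j \<in> {2..N}"
      and le: "g * lev j * a j \<le> \<bar>y (j * h) powr (m + 1) - u j powr (m + 1)\<bar>" for g j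
  proof -
    have "g * lev j * a j \<le> \<delta> + h * W * D * (\<Sum>i=1..<j. a i)"
      using le residual[OF j] by linarith
    then have "a j \<le> (\<delta> + h * W * D * (\<Sum>i=1..<j. a i)) / (g * lev j)"
      using g levpos[of j] j by (simp add: pos_le_divide_eq mult_ac)
    also have "\<delta> + h * W * D * (\<Sum>i=1..<j. a i) = h * W * D * ((\<Sum>i=1..<j. a i) + \<delta> / (h * W * D))"
      using h W D by (simp add: distrib_left)
    also have "\<dots> / (g * lev j) = (h * W * D) / (g * lev j) * ((\<Sum>i=1..<j. a i) + \<delta> / (h * W * D))"
      by simp
    also have "(h * W * D) / (g * lev j) = k' / g / j"
      using h m C g j by (simp add: lev_def k'_def field_simps)
    finally show ?thesis .
  qed
  have larger: "lev j * a j \<le> \<bar>y (j * h) powr (m + 1) - u j powr (m + 1)\<bar>" if "j \<in> {2..N}" for j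
    using powr_diff_ge_larger[OF m ypos upos y_low, of j j] that by (simp add: a_def)
  have "a n \<le> k' * (1 + k') ^ nat \<lceil>m\<rceil> * (a 1 + \<delta> / (h * W * D)) * real n powr (k' / G - 1)"
  proof (rule gronwall_one_over_n)
    show "0 \<le> \<delta> / (h * W * D)"
      using abs_quad_error_le_consistency_error[of 1 N X w K y] N h W D by (simp add: \<delta>_def)
    have k': "0 \<le> k'" using m C W D by (simp add: k'_def)
    then show "0 \<le> k' / G" "k' / G \<le> k'"
      by (auto simp: G_def divide_le_eq mult_le_cancel_left1)
    fix j assume j: "j \<in> {2..N}"
    show "a j \<le> k' / j * ((\<Sum>i=1..<j. a i) + \<delta> / (h * W * D))"
      using solve[of 1 j] larger j by simp
    assume "nat \<lceil>m\<rceil> \<le> j"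
    then have mj: "m \<le> j" by linarith
    have "E * lev j \<le> 1 * lev j" using E1 levpos[of j] j by (intro mult_right_mono) auto
    then have "E * lev j \<le> y (j * h) powr m" using y_low[of j] j by simp
    moreover have "E * lev j \<le> u j powr m"
      using bounds(2)[OF _ _ _ _ _ j mj] by (simp add: lev_def)
    ultimately have "(m + 1) * (E * lev j) * a j \<le> \<bar>y (j * h) powr (m + 1) - u j powr (m + 1)\<bar>"
      unfolding a_def using j by (intro powr_diff_ge_smaller m ypos upos) auto
    then have "G * lev j * a j \<le> \<bar>y (j * h) powr (m + 1) - u j powr (m + 1)\<bar>"
      using larger[OF j] by (simp add: G_def max_def mult.assoc)
    then show "a j \<le> k' / G / j * ((\<Sum>i=1..<j. a i) + \<delta> / (h * W * D))"
      using j by (intro solve) (auto simp: G_def)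
  qed (use n in \<open>auto simp: a_def\<close>)
  then show ?thesis by (simp add: a_def \<delta>_def G_def)
qed

section \<open>Convergence of the explicit scheme\<close>

theorem theorem1:
  fixes m X C D W p :: real
    and K :: "real \<Rightarrow> real \<Rightarrow> real"
    and y :: "real \<Rightarrow> real"
    and w :: "nat \<Rightarrow> nat \<Rightarrow> nat \<Rightarrow> real"
    and Y :: "nat \<Rightarrow> nat \<Rightarrow> real"
  defines "h \<equiv> grid_step X"
    and "e \<equiv> (\<lambda>N n. y (real n * grid_step X N) - Y N n)"
    and "\<delta> \<equiv> (\<lambda>N. consistency_error X K y (w N) N)"
    and "\<epsilon> \<equiv> (\<lambda>N. root_consistency_error m X (w N) N)"
    and "E \<equiv> (\<lambda>N. E_factor m X (w N) N)"
  assumes "0 < m" and "0 < X" and "0 < C" and "0 < W" and "0 < p"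
    and "continuous_on ({0..X} \<times> {0..X}) (\<lambda>(x, t). K x t)"
    and "\<forall>x\<in>{0..X}. \<forall>t\<in>{0..X}. C \<le> K x t \<and> K x t \<le> D"
    and "positive_solution m X K y"
    and "\<forall>N\<ge>1. \<forall>n\<in>{2..N}. \<forall>i\<in>{1..<n}. 0 < w N n i \<and> w N n i \<le> W"
    and "\<forall>N\<ge>1. explicit_scheme m X K (w N) N (Y N)"
    and "\<forall>\<^sub>F N in sequentially. \<epsilon> N * h N powr (- ((m + 1) / m)) < 1"
    and "\<forall>\<^sub>F N in sequentially. 0 < E N"
    and "\<forall>\<^sub>F N in sequentially.
           Y N 1 \<ge> (1 - (m + 1) / m * (\<epsilon> N / h N powr (1 + 1 / m)))
                     * (C * (m / (m + 1)) * h N) powr (1 / m)"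
    and "(\<lambda>N. e N 1) \<in> O(\<lambda>N. h N powr p)"
  shows "(\<forall>x\<in>{0<..X}. \<exists>c>0. \<forall>n :: nat \<Rightarrow> nat.
            (\<forall>N\<ge>1. n N \<in> {1..N}) \<and> (\<lambda>N. real (n N) * h N) \<longlonglongrightarrow> x \<longrightarrow>
            (\<forall>\<^sub>F N in sequentially.
               \<bar>e N (n N)\<bar> \<le> c * h N powr (1 - 1 / m * (W * D / (C * E N)))
                              * max (h N powr p) (\<delta> N / h N)))
         \<and> E \<in> O(\<lambda>_. 1)"
proof (intro conjI ballI)
  note asm = assms(6-)
  have m: "0 < m" and X: "0 < X" and C: "0 < C" and W: "0 < W" by (fact asm)+
  note K = asm(6) and KCD = asm(7) and sol = asm(8)
  have w: "\<forall>n\<in>{2..N}. \<forall>i\<in>{1..<n}. 0 < w N n i \<and> w N n i \<le> W" if "2 \<le> N" for N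
    using asm(9) that by auto
  have scheme: "explicit_scheme m X K (w N) N (Y N)" if "2 \<le> N" for N
    using asm(10) that by auto
  have h: "0 < h N" if "2 \<le> N" for N using that X by (simp add: h_def grid_step_def)
  have h_lim: "h \<longlonglongrightarrow> 0"
    unfolding h_def grid_step_def[abs_def] by (rule lim_const_over_n)
  have D: "0 < D" using KCD C X by (force intro: less_le_trans[of 0 C])
  have E1: "E N \<le> 1" if "2 \<le> N" for N
    unfolding E_def using m that by (rule E_factor_le_1)
  have start: "\<forall>\<^sub>F N in sequentially. E N * (C * (m / (m + 1)) * h N) powr (1 / m) \<le> Y N 1"
    using asm(13) eventually_ge_at_top[of 2]
  proof eventually_elim
    case (elim N)
    have "1 + 1 / m = (m + 1) / m" using m by (simp add: field_simps)
    then have "\<epsilon> N / h N powr (1 + 1 / m) = \<epsilon> N * h N powr (- ((m + 1) / m))"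
      using h[OF elim(2)] by (simp add: powr_minus divide_inverse)
    then show ?case
      using elim(1) by (simp add: E_def E_factor_def \<epsilon>_def h_def mult.assoc)
  qed
  obtain c1 where c1: "0 < c1"
    and e1: "\<forall>\<^sub>F N in sequentially. \<bar>e N 1\<bar> \<le> c1 * h N powr p"
    using asm(14) by (auto elim!: landau_o.bigE)
  show "E \<in> O(\<lambda>_. 1)"
  proof (rule bigoI[of _ 1])
    show "\<forall>\<^sub>F N in sequentially. norm (E N) \<le> 1 * norm (1 :: real)"
      using asm(12) eventually_ge_at_top[of 2] by eventually_elim (use E1 in auto)
  qed
  fix x assume x: "x \<in> {0<..X}"
  define k' where "k' = (m + 1) / m * (W * D / C)"
  have k': "0 < k'" using m W D C by (simp add: k'_def)
  define A where "A = k' * (1 + k') ^ nat \<lceil>m\<rceil> * (c1 + 1 / (W * D))"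
  have A: "0 < A" using k' c1 W D by (simp add: A_def add_pos_pos)
  define B where "B = (1 + X) powr k' + 1 / (x / 2)"
  have B: "0 < B" using X x by (simp add: B_def add_pos_pos)
  show "\<exists>c>0. \<forall>n :: nat \<Rightarrow> nat.
            (\<forall>N\<ge>1. n N \<in> {1..N}) \<and> (\<lambda>N. real (n N) * h N) \<longlonglongrightarrow> x \<longrightarrow>
            (\<forall>\<^sub>F N in sequentially.
               \<bar>e N (n N)\<bar> \<le> c * h N powr (1 - 1 / m * (W * D / (C * E N)))
                              * max (h N powr p) (\<delta> N / h N))"
  proof (intro exI[of _ "A * B"] conjI allI impI)
    show "0 < A * B" using A B by simp
    fix n :: "nat \<Rightarrow> nat"
    assume n: "(\<forall>N\<ge>1. n N \<in> {1..N}) \<and> (\<lambda>N. real (n N) * h N) \<longlonglongrightarrow> x"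
    have far: "\<forall>\<^sub>F N in sequentially. x / 2 < n N * h N"
      using n x by (intro order_tendstoD) auto
    have small: "\<forall>\<^sub>F N in sequentially. h N < min 1 (x / 2)"
      using x by (intro order_tendstoD(2)[OF h_lim]) auto
    show "\<forall>\<^sub>F N in sequentially. \<bar>e N (n N)\<bar>
        \<le> A * B * h N powr (1 - 1 / m * (W * D / (C * E N))) * max (h N powr p) (\<delta> N / h N)"
      using far small e1 start asm(12) eventually_ge_at_top[of 2]
    proof eventually_elim
      case (elim N)
      note N = elim(6) and EN = elim(5)
      define z where "z = n N * h N"
      define M where "M = max (h N powr p) (\<delta> N / h N)"
      define k where "k = k' / max 1 ((m + 1) * E N)"
      have hN: "0 < h N" "h N \<le> 1" using h[OF N] elim(2) by auto
      have nN: "n N \<in> {1..N}" using n N by simp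
      \<comment> \<open>\<open>n N = 1\<close> would give \<open>n N * h N = h N\<close>, which is below \<open>x/2\<close> for these \<open>N\<close>.\<close>
      have "n N \<noteq> 1" using elim(1,2) by auto
      then have n2: "n N \<in> {2..N}" using nN by auto
      have "n N * h N \<le> N * h N" using nN hN by (intro mult_right_mono) auto
      then have zX: "z \<le> X" using N by (simp add: z_def h_def grid_step_def)
      have k: "0 \<le> k" "k \<le> k'"
        using k' by (auto simp: k_def divide_le_eq mult_le_cancel_left1)
      have "k \<le> k' / ((m + 1) * E N)"
        unfolding k_def using k' m EN by (intro divide_left_mono) auto
      also have "\<dots> = 1 / m * (W * D / (C * E N))"
        using m C EN by (simp add: k'_def)
      finally have k_le: "k \<le> 1 / m * (W * D / (C * E N))" .
      have M: "h N powr p \<le> M" "\<delta> N / h N \<le> M" "0 \<le> M"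
        by (auto simp: M_def le_max_iff_disj)
      have "\<bar>y (h N) - Y N 1\<bar> + \<delta> N / (h N * W * D) = \<bar>e N 1\<bar> + (\<delta> N / h N) * (1 / (W * D))"
        by (simp add: e_def h_def)
      also have "\<dots> \<le> c1 * M + M * (1 / (W * D))"
        using elim(3) M c1 W D
        by (intro add_mono mult_right_mono order_trans[OF elim(3)] mult_left_mono) auto
      finally have data: "\<bar>y (h N) - Y N 1\<bar> + \<delta> N / (h N * W * D) \<le> (c1 + 1 / (W * D)) * M"
        by (simp add: algebra_simps)
      \<comment> \<open>As \<open>z\<close> stays in \<open>[x/2, X]\<close> and \<open>k - 1\<close> in \<open>[-1, k']\<close>, the factor \<open>z powr (k - 1)\<close> is bounded
        by \<open>B\<close>. Passing from \<open>k\<close> to the exponent of the claim uses \<open>h N \<le> 1\<close>.\<close>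
      have "real (n N) powr (k - 1) = z powr (k - 1) / h N powr (k - 1)"
        using hN by (simp add: powr_mult z_def)
      also have "\<dots> = z powr (k - 1) * h N powr (1 - k)"
        using hN by (simp add: powr_diff)
      also have "\<dots> \<le> B * h N powr (1 - 1 / m * (W * D / (C * E N)))"
        unfolding B_def using x elim(1) zX k k' hN k_le
        by (intro mult_mono powr_le_between powr_mono') (auto simp: z_def add_nonneg_nonneg)
      finally have growth: "real (n N) powr (k - 1) \<le> B * h N powr (1 - 1 / m * (W * D / (C * E N)))" .
      have "\<bar>e N (n N)\<bar> \<le> k' * (1 + k') ^ nat \<lceil>m\<rceil>
          * (\<bar>y (h N) - Y N 1\<bar> + \<delta> N / (h N * W * D)) * real (n N) powr (k - 1)"
        unfolding e_def k'_def k_def \<delta>_def h_def E_def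
        using EN elim(4)
        by (intro scheme_error_bound[OF m X C W K KCD sol w[OF N] scheme[OF N] n2])
           (auto simp: E_def h_def)
      also have "\<dots> \<le> k' * (1 + k') ^ nat \<lceil>m\<rceil> * ((c1 + 1 / (W * D)) * M)
          * (B * h N powr (1 - 1 / m * (W * D / (C * E N))))"
        using data growth k' c1 W D M by (intro mult_mono mult_left_mono) auto
      also have "\<dots> = A * B * h N powr (1 - 1 / m * (W * D / (C * E N))) * M"
        by (simp add: A_def)
      finally show ?case by (simp add: M_def)
    qed
  qed
qed

end
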